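(* Let $n\ge1$. The map $$f:\Theta_{CH_n}^{can}/(S_n\rtimes_\phi\mathbb{T}^n)\to\mathcal{X}^n_\uparrow\times\mathbb{R}_+^n,\qquad f([{\bf d},{\bf v}])=({\bf d}_\uparrow,\mathcal{R}(\Gamma_\sigma({\bf v}))),$$ where $\sigma\in S_n$ is the unique permutation such that $\Gamma_\sigma({\bf d})={\bf d}_\uparrow$, is an isomorphism, that is, a well-defined bijection.
   Context: $\mathbb{R}_+$ is the set of positive reals. $\Theta_{CH_n}^{can}$ is the set of pairs $({\bf d},{\bf v})$ with ${\bf d}=(d_1,\dots,d_n)^T\in\mathbb{R}_+^n$ having pairwise distinct entries and ${\bf v}=(v_1,\dots,v_{2n})^T\in\mathbb{R}^{2n}$ satisfying $v_l^2+v_{n+l}^2>0$ for all $l=1,\dots,n$. For $\sigma\in S_n$ let $P_\sigma$ be the permutation matrix with $P_\sigma(x_1,\dots,x_n)^T=(x_{\sigma(1)},\dots,x_{\sigma(n)})^T$, and set $\Gamma_\sigma({\bf d})=P_\sigma{\bf d}$, $\Gamma_\sigma({\bf v})=\begin{bmatrix}P_\sigma&0\\0&P_\sigma\end{bmatrix}{\bf v}$. For $\theta\in\mathbb{T}^n$ let $R_\theta=\begin{bmatrix}\mathrm{diag}(\cos\theta_i)&-\mathrm{diag}(\sin\theta_i)\\ \mathrm{diag}(\sin\theta_i)&\mathrm{diag}(\cos\theta_i)\end{bmatrix}$. The semi-direct product $S_n\rtimes_\phi\mathbb{T}^n$, with $\phi(\sigma)(\theta)=P_\sigma\theta$ (and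 the product of $S_n$ taken so that $P_{\sigma\bar\sigma}=P_\sigma P_{\bar\sigma}$), acts on $\Theta_{CH_n}^{can}$ by $\Gamma_{(\sigma,\theta)}({\bf d},{\bf v})=(P_\sigma{\bf d},R_\theta\Gamma_\sigma({\bf v}))$; $[{\bf d},{\bf v}]$ denotes the orbit of $({\bf d},{\bf v})$. ${\bf d}_\uparrow$ is the vector obtained from ${\bf d}$ by placing its entries in increasing order. $\mathcal{X}^n_\uparrow$ is the set of vectors in $\mathbb{R}^n_+$ with distinct entries in increasing order. $\mathcal{R}:\mathbb{R}^{2n}\to\mathbb{R}^n_{\ge0}$ is $\mathcal{R}((v_1,\dots,v_{2n})^T)=(v_1^2+v_{n+1}^2,\dots,v_n^2+v_{2n}^2)$. *)

theory Defs
  imports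
    "Jordan_Normal_Form.Matrix"
    "HOL-Algebra.Group_Action"
    "HOL-Combinatorics.Permutations"
    "HOL-Library.Real_Mod"
begin

text \<open>
  Column vectors and matrices are those of \<^theory>\<open>Jordan_Normal_Form.Matrix\<close>, so coordinates are
  numbered from 0: the index set is \<open>{..<n}\<close>, and the entries \<open>v_l\<close> and \<open>v_(n+l)\<close> of a vector in
  \<open>R^(2n)\<close> are \<open>v $ l\<close> and \<open>v $ (n + l)\<close> for \<open>l < n\<close>.
\<close>

section \<open>Parameter space\<close>

definition pos_vecs :: "nat \<Rightarrow> real vec set" where
  "pos_vecs n = {d \<in> carrier_vec n. \<forall>i<n. d $ i > 0}"

definition Theta :: "nat \<Rightarrow> (real vec \<times> real vec) set" where
  "Theta n = {(d, v). d \<in> pos_vecs n \<and> distinct (list_of_vec d) \<and>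
                      v \<in> carrier_vec (2 * n) \<and> (\<forall>l<n. (v $ l)\<^sup>2 + (v $ (n + l))\<^sup>2 > 0)}"

section \<open>Groups\<close>

text \<open>
  Permutations are multiplied in the order for which \<open>perm_matrix n\<close> is multiplicative; since
  \<open>perm_matrix n \<sigma>\<close> sends \<open>x\<close> to \<open>(x (\<sigma> i))_i\<close>, this is the opposite of composition
  (see \<open>perm_matrix_mult\<close> below).
\<close>

definition Sn :: "nat \<Rightarrow> (nat \<Rightarrow> nat) monoid" where
  "Sn n = \<lparr>carrier = {\<sigma>. \<sigma> permutes {..<n}}, mult = (\<lambda>\<sigma> \<tau>. \<tau> \<circ> \<sigma>), one = id\<rparr>"

text \<open>The torus \<open>(R / 2 pi Z)^n\<close>, each class being represented by its element in \<open>[0, 2 pi)^n\<close>.\<close>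

definition torus :: "nat \<Rightarrow> real vec monoid" where
  "torus n = \<lparr>carrier = {\<theta> \<in> carrier_vec n. \<forall>i<n. 0 \<le> \<theta> $ i \<and> \<theta> $ i < 2 * pi},
              mult = (\<lambda>\<theta> \<eta>. vec n (\<lambda>i. (\<theta> $ i + \<eta> $ i) rmod (2 * pi))),
              one = 0\<^sub>v n\<rparr>"

definition semidirect ::
  "('a, 'c) monoid_scheme \<Rightarrow> ('b, 'd) monoid_scheme \<Rightarrow> ('a \<Rightarrow> 'b \<Rightarrow> 'b) \<Rightarrow> ('a \<times> 'b) monoid" where
  "semidirect G H \<phi> =
     \<lparr>carrier = carrier G \<times> carrier H,
      mult = (\<lambda>(g, h) (g', h'). (g \<otimes>\<^bsub>G\<^esub> g', h \<otimes>\<^bsub>H\<^esub> \<phi> g h')),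
      one = (\<one>\<^bsub>G\<^esub>, \<one>\<^bsub>H\<^esub>)\<rparr>"

definition perm_matrix :: "nat \<Rightarrow> (nat \<Rightarrow> nat) \<Rightarrow> real mat" where
  "perm_matrix n \<sigma> = mat n n (\<lambda>(i, j). if j = \<sigma> i then 1 else 0)"

definition SnT :: "nat \<Rightarrow> ((nat \<Rightarrow> nat) \<times> real vec) monoid" where
  "SnT n = semidirect (Sn n) (torus n) (\<lambda>\<sigma> \<theta>. perm_matrix n \<sigma> *\<^sub>v \<theta>)"

section \<open>Group action\<close>

definition perm_matrix2 :: "nat \<Rightarrow> (nat \<Rightarrow> nat) \<Rightarrow> real mat" where
  "perm_matrix2 n \<sigma> =
     four_block_mat (perm_matrix n \<sigma>) (0\<^sub>m n n) (0\<^sub>m n n) (perm_matrix n \<sigma>)"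

definition rot_matrix :: "nat \<Rightarrow> real vec \<Rightarrow> real mat" where
  "rot_matrix n \<theta> =
     four_block_mat (mat_diag n (\<lambda>i. cos (\<theta> $ i))) (- mat_diag n (\<lambda>i. sin (\<theta> $ i)))
                    (mat_diag n (\<lambda>i. sin (\<theta> $ i))) (mat_diag n (\<lambda>i. cos (\<theta> $ i)))"

text \<open>The restriction makes each group element act as an element of \<^term>\<open>Bij (Theta n)\<close>.\<close>

definition Gamma :: "nat \<Rightarrow> (nat \<Rightarrow> nat) \<times> real vec \<Rightarrow> real vec \<times> real vec \<Rightarrow> real vec \<times> real vec"
  where
  "Gamma n = (\<lambda>(\<sigma>, \<theta>). \<lambda>(d, v)\<in>Theta n.
     (perm_matrix n \<sigma> *\<^sub>v d, rot_matrix n \<theta> *\<^sub>v (perm_matrix2 n \<sigma> *\<^sub>v v)))"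

section \<open>The map on the orbit space\<close>

definition sort_vec :: "real vec \<Rightarrow> real vec" where
  "sort_vec d = vec_of_list (sort (list_of_vec d))"

definition X_up :: "nat \<Rightarrow> real vec set" where
  "X_up n = {x \<in> pos_vecs n. distinct (list_of_vec x) \<and> sorted (list_of_vec x)}"

definition R_map :: "nat \<Rightarrow> real vec \<Rightarrow> real vec" where
  "R_map n v = vec n (\<lambda>i. (v $ i)\<^sup>2 + (v $ (n + i))\<^sup>2)"

text \<open>
  The value on an orbit \<open>Q\<close>, read off from any representative. That it does not depend on the
  representative (so that the definite description denotes) is not built into the definition.
\<close>

definition f_map :: "nat \<Rightarrow> (real vec \<times> real vec) set \<Rightarrow> real vec \<times> real vec" where
  "f_map n Q = (THE y. \<exists>(d, v)\<in>Q. \<exists>\<sigma>\<in>carrier (Sn n).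
     perm_matrix n \<sigma> *\<^sub>v d = sort_vec d \<and> y = (sort_vec d, R_map n (perm_matrix2 n \<sigma> *\<^sub>v v)))"

section \<open>The conventions give a group acting on the parameter space\<close>

lemma perm_less: "\<sigma> \<in> carrier (Sn n) \<Longrightarrow> i < n \<Longrightarrow> \<sigma> i < n"
  unfolding Sn_def using permutes_in_image[of \<sigma> "{..<n}" i] by simp

lemma perm_matrix_carrier [simp]: "perm_matrix n \<sigma> \<in> carrier_mat n n"
  by (simp add: perm_matrix_def)

lemma perm_matrix2_carrier [simp]: "perm_matrix2 n \<sigma> \<in> carrier_mat (2 * n) (2 * n)"
  unfolding perm_matrix2_def mult_2 by (intro four_block_carrier_mat) auto

lemma rot_matrix_carrier [simp]: "rot_matrix n \<theta> \<in> carrier_mat (2 * n) (2 * n)"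
  unfolding rot_matrix_def mult_2 by (intro four_block_carrier_mat) auto

lemma sum_if:
  fixes g h :: "nat \<Rightarrow> real"
  assumes "k < n"
  shows "(\<Sum>j=0..<n. (if j = k then g j else 0) * h j) = g k * h k"
proof -
  have "(\<Sum>j=0..<n. (if j = k then g j else 0) * h j) = (\<Sum>j=0..<n. if j = k then g j * h j else 0)"
    by (intro sum.cong) auto
  then show ?thesis using assms by simp
qed

lemma perm_matrix_vec:
  assumes "\<sigma> \<in> carrier (Sn n)" "x \<in> carrier_vec n"
  shows "perm_matrix n \<sigma> *\<^sub>v x = vec n (\<lambda>i. x $ \<sigma> i)"
proof (rule eq_vecI)
  fix i assume "i < dim_vec (vec n (\<lambda>i. x $ \<sigma> i))"
  then have i: "i < n" by simp
  have "(perm_matrix n \<sigma> *\<^sub>v x) $ i = (\<Sum>j=0..<n. (if j = \<sigma> i then 1 else 0) * x $ j)"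
    using i assms(2) by (simp add: perm_matrix_def scalar_prod_def)
  also have "\<dots> = x $ \<sigma> i" using sum_if[OF perm_less[OF assms(1) i], of "\<lambda>_. 1"] by simp
  finally show "(perm_matrix n \<sigma> *\<^sub>v x) $ i = vec n (\<lambda>i. x $ \<sigma> i) $ i" using i by simp
qed (simp add: perm_matrix_def)

lemma perm_matrix_mult:
  assumes "\<sigma> \<in> carrier (Sn n)" "\<tau> \<in> carrier (Sn n)"
  shows "perm_matrix n (\<sigma> \<otimes>\<^bsub>Sn n\<^esub> \<tau>) = perm_matrix n \<sigma> * perm_matrix n \<tau>"
proof (rule eq_matI)
  fix i j assume "i < dim_row (perm_matrix n \<sigma> * perm_matrix n \<tau>)"
    "j < dim_col (perm_matrix n \<sigma> * perm_matrix n \<tau>)"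
  then have ij: "i < n" "j < n" by (simp_all add: perm_matrix_def)
  have "(perm_matrix n \<sigma> * perm_matrix n \<tau>) $$ (i, j)
      = (\<Sum>k=0..<n. (if k = \<sigma> i then 1 else 0) * (if j = \<tau> k then 1 else 0))"
    using ij by (simp add: perm_matrix_def scalar_prod_def)
  also have "\<dots> = (if j = \<tau> (\<sigma> i) then 1 else 0)"
    using sum_if[OF perm_less[OF assms(1) ij(1)], of "\<lambda>_. 1"] by simp
  finally show "perm_matrix n (\<sigma> \<otimes>\<^bsub>Sn n\<^esub> \<tau>) $$ (i, j) = (perm_matrix n \<sigma> * perm_matrix n \<tau>) $$ (i, j)"
    using ij by (simp add: perm_matrix_def Sn_def)
qed (simp_all add: perm_matrix_def)

lemma vec_split:
  "v \<in> carrier_vec (2 * n) \<Longrightarrow> v = vec n (\<lambda>i. v $ i) @\<^sub>v vec n (\<lambda>i. v $ (n + i))"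
  by (rule eq_vecI) auto

lemma perm_matrix2_vec:
  assumes "\<sigma> \<in> carrier (Sn n)" "v \<in> carrier_vec (2 * n)"
  shows "perm_matrix2 n \<sigma> *\<^sub>v v = vec n (\<lambda>i. v $ \<sigma> i) @\<^sub>v vec n (\<lambda>i. v $ (n + \<sigma> i))"
proof -
  have "perm_matrix2 n \<sigma> *\<^sub>v v
      = perm_matrix2 n \<sigma> *\<^sub>v (vec n (\<lambda>i. v $ i) @\<^sub>v vec n (\<lambda>i. v $ (n + i)))"
    using vec_split[OF assms(2)] by simp
  also have "\<dots> = (perm_matrix n \<sigma> *\<^sub>v vec n (\<lambda>i. v $ i)) @\<^sub>v (perm_matrix n \<sigma> *\<^sub>v vec n (\<lambda>i. v $ (n + i)))"
    unfolding perm_matrix2_def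
    by (subst four_block_mat_mult_vec[of _ n n _ n _ n])
       (auto simp: perm_matrix_def intro!: eq_vecI)
  also have "\<dots> = vec n (\<lambda>i. v $ \<sigma> i) @\<^sub>v vec n (\<lambda>i. v $ (n + \<sigma> i))"
    using assms(1) by (auto simp: perm_matrix_vec perm_less intro!: eq_vecI)
  finally show ?thesis .
qed

lemma mat_diag_vec: "x \<in> carrier_vec n \<Longrightarrow> mat_diag n f *\<^sub>v x = vec n (\<lambda>i. f i * x $ i)"
  for f :: "nat \<Rightarrow> real"
proof (rule eq_vecI)
  fix i assume x: "x \<in> carrier_vec n" and "i < dim_vec (vec n (\<lambda>i. f i * x $ i))"
  then have i: "i < n" by simp
  have "(mat_diag n f *\<^sub>v x) $ i = (\<Sum>j=0..<n. (if j = i then f j else 0) * x $ j)"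
    using i x by (simp add: mat_diag_def scalar_prod_def eq_commute[of i])
  also have "\<dots> = f i * x $ i" using i by (rule sum_if)
  finally show "(mat_diag n f *\<^sub>v x) $ i = vec n (\<lambda>i. f i * x $ i) $ i" using i by simp
qed (simp add: mat_diag_def)

lemma rot_matrix_vec:
  assumes "v \<in> carrier_vec (2 * n)"
  shows "rot_matrix n \<theta> *\<^sub>v v =
    vec n (\<lambda>i. cos (\<theta> $ i) * v $ i - sin (\<theta> $ i) * v $ (n + i)) @\<^sub>v
    vec n (\<lambda>i. sin (\<theta> $ i) * v $ i + cos (\<theta> $ i) * v $ (n + i))"
proof -
  have neg: "- mat_diag n g = mat_diag n (\<lambda>i. - g i)" for g :: "nat \<Rightarrow> real"
    by (rule eq_matI) (auto simp: mat_diag_def)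
  have "rot_matrix n \<theta> *\<^sub>v v
      = rot_matrix n \<theta> *\<^sub>v (vec n (\<lambda>i. v $ i) @\<^sub>v vec n (\<lambda>i. v $ (n + i)))"
    using vec_split[OF assms] by simp
  also have "\<dots> = vec n (\<lambda>i. cos (\<theta> $ i) * v $ i - sin (\<theta> $ i) * v $ (n + i)) @\<^sub>v
    vec n (\<lambda>i. sin (\<theta> $ i) * v $ i + cos (\<theta> $ i) * v $ (n + i))"
    unfolding rot_matrix_def neg
    by (subst four_block_mat_mult_vec[of _ n n _ n _ n]) (auto simp: mat_diag_vec intro!: eq_vecI)
  finally show ?thesis .
qed

lemma Gamma_vec:
  assumes "\<sigma> \<in> carrier (Sn n)" "(d, v) \<in> Theta n"
  shows "Gamma n (\<sigma>, \<theta>) (d, v) =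
    (vec n (\<lambda>i. d $ \<sigma> i),
     vec n (\<lambda>i. cos (\<theta> $ i) * v $ \<sigma> i - sin (\<theta> $ i) * v $ (n + \<sigma> i)) @\<^sub>v
     vec n (\<lambda>i. sin (\<theta> $ i) * v $ \<sigma> i + cos (\<theta> $ i) * v $ (n + \<sigma> i)))"
proof -
  have c: "d \<in> carrier_vec n" "v \<in> carrier_vec (2 * n)"
    using assms(2) by (auto simp: Theta_def pos_vecs_def)
  have c': "perm_matrix2 n \<sigma> *\<^sub>v v \<in> carrier_vec (2 * n)"
    using mult_mat_vec_carrier[OF perm_matrix2_carrier c(2)] .
  show ?thesis
    using assms(2) rot_matrix_vec[OF c', of \<theta>] perm_matrix_vec[OF assms(1) c(1)]
    by (auto simp: Gamma_def perm_matrix2_vec[OF assms(1) c(2)] intro!: eq_vecI)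
qed

lemma group_Sn: "group (Sn n)"
proof (rule groupI)
  fix \<sigma> assume "\<sigma> \<in> carrier (Sn n)"
  then have "inv_into UNIV \<sigma> \<in> carrier (Sn n) \<and> inv_into UNIV \<sigma> \<otimes>\<^bsub>Sn n\<^esub> \<sigma> = \<one>\<^bsub>Sn n\<^esub>"
    by (simp add: Sn_def permutes_inv permutes_inv_o)
  then show "\<exists>\<tau>\<in>carrier (Sn n). \<tau> \<otimes>\<^bsub>Sn n\<^esub> \<sigma> = \<one>\<^bsub>Sn n\<^esub>" by blast
qed (auto simp: Sn_def permutes_compose permutes_id comp_assoc)

lemma group_torus: "group (torus n)"
proof (rule groupI)
  fix \<theta> assume t: "\<theta> \<in> carrier (torus n)"
  define \<eta> where "\<eta> = vec n (\<lambda>i. (- \<theta> $ i) rmod (2 * pi))"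
  have "\<eta> \<in> carrier (torus n)" by (simp add: torus_def \<eta>_def rmod_less rmod_nonneg)
  moreover have "((- \<theta> $ i) rmod (2 * pi) + \<theta> $ i) rmod (2 * pi) = 0" if "i < n" for i
  proof -
    have "((- \<theta> $ i) rmod (2 * pi) + \<theta> $ i rmod (2 * pi)) rmod (2 * pi) = 0"
      unfolding rmod_add by simp
    then show ?thesis using t that by (simp add: torus_def)
  qed
  ultimately show "\<exists>\<eta>\<in>carrier (torus n). \<eta> \<otimes>\<^bsub>torus n\<^esub> \<theta> = \<one>\<^bsub>torus n\<^esub>"
    by (intro bexI[of _ \<eta>]) (auto simp: torus_def \<eta>_def intro!: eq_vecI)
next
  fix \<theta> \<eta> \<zeta> assume t: "\<theta> \<in> carrier (torus n)" "\<eta> \<in> carrier (torus n)" "\<zeta> \<in> carrier (torus n)"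
  have "((a + b) rmod (2 * pi) + c) rmod (2 * pi) = (a + (b + c) rmod (2 * pi)) rmod (2 * pi)"
    for a b c :: real
    by (metis rmod_add rmod_rmod add.assoc)
  then show "\<theta> \<otimes>\<^bsub>torus n\<^esub> \<eta> \<otimes>\<^bsub>torus n\<^esub> \<zeta> = \<theta> \<otimes>\<^bsub>torus n\<^esub> (\<eta> \<otimes>\<^bsub>torus n\<^esub> \<zeta>)"
    by (auto simp: torus_def)
qed (auto simp: torus_def rmod_less rmod_nonneg intro!: eq_vecI)

lemma SnT_carrier: "carrier (SnT n) = carrier (Sn n) \<times> carrier (torus n)"
  by (simp add: SnT_def semidirect_def)

lemma perm_torus:
  "\<sigma> \<in> carrier (Sn n) \<Longrightarrow> \<theta> \<in> carrier (torus n) \<Longrightarrow>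
   perm_matrix n \<sigma> *\<^sub>v \<theta> = vec n (\<lambda>i. \<theta> $ \<sigma> i)"
  by (simp add: perm_matrix_vec torus_def)

lemma perm_torus_carrier:
  "\<sigma> \<in> carrier (Sn n) \<Longrightarrow> \<theta> \<in> carrier (torus n) \<Longrightarrow> perm_matrix n \<sigma> *\<^sub>v \<theta> \<in> carrier (torus n)"
  by (subst perm_torus) (auto simp: torus_def perm_less)

lemma SnT_mult:
  "(\<sigma>, \<theta>) \<otimes>\<^bsub>SnT n\<^esub> (\<tau>, \<eta>) = (\<sigma> \<otimes>\<^bsub>Sn n\<^esub> \<tau>, \<theta> \<otimes>\<^bsub>torus n\<^esub> (perm_matrix n \<sigma> *\<^sub>v \<eta>))"
  by (simp add: SnT_def semidirect_def)

lemma group_SnT: "group (SnT n)"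
proof -
  interpret S: group "Sn n" by (rule group_Sn)
  interpret T: group "torus n" by (rule group_torus)
  have hom: "perm_matrix n \<sigma> *\<^sub>v (\<theta> \<otimes>\<^bsub>torus n\<^esub> \<eta>)
      = (perm_matrix n \<sigma> *\<^sub>v \<theta>) \<otimes>\<^bsub>torus n\<^esub> (perm_matrix n \<sigma> *\<^sub>v \<eta>)"
    if "\<sigma> \<in> carrier (Sn n)" "\<theta> \<in> carrier (torus n)" "\<eta> \<in> carrier (torus n)" for \<sigma> \<theta> \<eta>
    using that
    by (subst (1 2 3) perm_torus) (auto simp: torus_def perm_less rmod_less rmod_nonneg intro!: eq_vecI)
  have act: "perm_matrix n (\<sigma> \<otimes>\<^bsub>Sn n\<^esub> \<tau>) *\<^sub>v \<theta> = perm_matrix n \<sigma> *\<^sub>v (perm_matrix n \<tau> *\<^sub>v \<theta>)"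
    if "\<sigma> \<in> carrier (Sn n)" "\<tau> \<in> carrier (Sn n)" "\<theta> \<in> carrier (torus n)" for \<sigma> \<tau> \<theta>
    using that assoc_mult_mat_vec[OF perm_matrix_carrier perm_matrix_carrier]
    by (simp add: perm_matrix_mult torus_def)
  have one: "perm_matrix n \<one>\<^bsub>Sn n\<^esub> *\<^sub>v \<theta> = \<theta>" if "\<theta> \<in> carrier (torus n)" for \<theta>
    by (subst perm_torus[OF S.one_closed that])
       (use that in \<open>auto simp: torus_def Sn_def intro!: eq_vecI\<close>)
  show ?thesis
  proof (rule groupI)
    fix x assume "x \<in> carrier (SnT n)"
    then obtain \<sigma> \<theta> where x: "x = (\<sigma>, \<theta>)" "\<sigma> \<in> carrier (Sn n)" "\<theta> \<in> carrier (torus n)"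
      by (auto simp: SnT_carrier)
    let ?s = "inv\<^bsub>Sn n\<^esub> \<sigma>"
    let ?t = "perm_matrix n ?s *\<^sub>v \<theta>"
    have "?t \<in> carrier (torus n)" using x by (simp add: perm_torus_carrier)
    then show "\<exists>y\<in>carrier (SnT n). y \<otimes>\<^bsub>SnT n\<^esub> x = \<one>\<^bsub>SnT n\<^esub>"
      using x by (intro bexI[of _ "(?s, inv\<^bsub>torus n\<^esub> ?t)"])
        (simp_all add: SnT_mult SnT_carrier, simp add: SnT_def semidirect_def)
  next
    fix x y z
    assume "x \<in> carrier (SnT n)" "y \<in> carrier (SnT n)" "z \<in> carrier (SnT n)"
    then show "x \<otimes>\<^bsub>SnT n\<^esub> y \<otimes>\<^bsub>SnT n\<^esub> z = x \<otimes>\<^bsub>SnT n\<^esub> (y \<otimes>\<^bsub>SnT n\<^esub> z)"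
      by (auto simp: SnT_carrier SnT_mult hom act perm_torus_carrier S.m_assoc T.m_assoc)
  next
    fix x assume "x \<in> carrier (SnT n)"
    moreover have "\<one>\<^bsub>SnT n\<^esub> = (\<one>\<^bsub>Sn n\<^esub>, \<one>\<^bsub>torus n\<^esub>)" by (simp add: SnT_def semidirect_def)
    ultimately show "\<one>\<^bsub>SnT n\<^esub> \<otimes>\<^bsub>SnT n\<^esub> x = x"
      by (auto simp: SnT_carrier SnT_mult one)
  next
    fix x y assume "x \<in> carrier (SnT n)" "y \<in> carrier (SnT n)"
    then show "x \<otimes>\<^bsub>SnT n\<^esub> y \<in> carrier (SnT n)"
      by (auto simp: SnT_carrier SnT_mult perm_torus_carrier)
  next
    show "\<one>\<^bsub>SnT n\<^esub> \<in> carrier (SnT n)" by (simp add: SnT_def semidirect_def)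
  qed
qed

lemma Gamma_closed:
  assumes g: "\<sigma> \<in> carrier (Sn n)" and x: "(d, v) \<in> Theta n"
  shows "Gamma n (\<sigma>, \<theta>) (d, v) \<in> Theta n"
proof -
  have inj: "\<sigma> i = \<sigma> j \<longleftrightarrow> i = j" for i j
    using g by (auto simp: Sn_def dest: permutes_inj injD)
  have rot: "(cos t * a - sin t * b)\<^sup>2 + (sin t * a + cos t * b)\<^sup>2 = a\<^sup>2 + b\<^sup>2" for t a b :: real
  proof -
    have "(c * a - s * b)\<^sup>2 + (s * a + c * b)\<^sup>2 = (s\<^sup>2 + c\<^sup>2) * (a\<^sup>2 + b\<^sup>2)" for c s :: real
      by (simp add: power2_eq_square algebra_simps)
    from this[of "cos t" "sin t"] show ?thesis by simp
  qed
  have "distinct (list_of_vec (vec n (\<lambda>i. d $ \<sigma> i)))"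
    using x perm_less[OF g] inj
    by (auto simp: Theta_def pos_vecs_def distinct_conv_nth list_of_vec_index)
  then show ?thesis
    unfolding Gamma_vec[OF g x] using x perm_less[OF g]
    by (auto simp: Theta_def pos_vecs_def rot intro!: carrier_vecI)
qed

lemma cos_rmod: "cos (x rmod (2 * pi)) = cos x"
proof -
  have "cos (x - 2 * pi * of_int k) = cos x" for k
    by (simp add: cos_diff)
  then show ?thesis by (simp add: rmod_def)
qed

lemma sin_rmod: "sin (x rmod (2 * pi)) = sin x"
proof -
  have "sin (x - 2 * pi * of_int k) = sin x" for k
    by (simp add: sin_diff)
  then show ?thesis by (simp add: rmod_def)
qed

lemma Gamma_mult:
  assumes g: "\<sigma> \<in> carrier (Sn n)" "\<theta> \<in> carrier (torus n)"
    and h: "\<tau> \<in> carrier (Sn n)" "\<eta> \<in> carrier (torus n)" and x: "(d, v) \<in> Theta n"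
  shows "Gamma n ((\<sigma>, \<theta>) \<otimes>\<^bsub>SnT n\<^esub> (\<tau>, \<eta>)) (d, v) = Gamma n (\<sigma>, \<theta>) (Gamma n (\<tau>, \<eta>) (d, v))"
proof -
  let ?y = "Gamma n (\<tau>, \<eta>) (d, v)"
  have y: "(fst ?y, snd ?y) \<in> Theta n" using Gamma_closed[OF h(1) x, of \<eta>] by simp
  have st: "\<sigma> \<otimes>\<^bsub>Sn n\<^esub> \<tau> \<in> carrier (Sn n)" by (intro monoid.m_closed group.is_monoid group_Sn g h)
  note less = perm_less[OF g(1)] perm_less[OF h(1)]
  have e: "\<theta> \<otimes>\<^bsub>torus n\<^esub> (perm_matrix n \<sigma> *\<^sub>v \<eta>) = vec n (\<lambda>i. (\<theta> $ i + \<eta> $ \<sigma> i) rmod (2 * pi))"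
    unfolding perm_torus[OF g(1) h(2)] by (auto simp: torus_def)
  have "Gamma n (\<sigma>, \<theta>) ?y = Gamma n (\<sigma>, \<theta>) (fst ?y, snd ?y)" by simp
  also have "\<dots> = Gamma n ((\<sigma>, \<theta>) \<otimes>\<^bsub>SnT n\<^esub> (\<tau>, \<eta>)) (d, v)"
    unfolding Gamma_vec[OF g(1) y] SnT_mult Gamma_vec[OF st x] e
    unfolding Gamma_vec[OF h(1) x]
    by (auto simp: less trans_less_add1 Sn_def cos_rmod sin_rmod cos_add sin_add intro!: eq_vecI;
        simp add: algebra_simps)
  finally show ?thesis by simp
qed

lemma Gamma_one: "x \<in> Theta n \<Longrightarrow> Gamma n \<one>\<^bsub>SnT n\<^esub> x = x"
proof -
  assume x: "x \<in> Theta n"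
  obtain d v where dv: "x = (d, v)" by (cases x)
  have "id \<in> carrier (Sn n)" by (simp add: Sn_def permutes_id)
  moreover have "\<one>\<^bsub>SnT n\<^esub> = (id, 0\<^sub>v n)" by (simp add: SnT_def semidirect_def Sn_def torus_def)
  ultimately show ?thesis
    using x unfolding dv
    by (auto simp: Gamma_vec Theta_def pos_vecs_def intro!: eq_vecI)
qed

lemma group_action_Gamma: "group_action (SnT n) (Theta n) (Gamma n)"
proof -
  interpret G: group "SnT n" by (rule group_SnT)
  have closed: "Gamma n g x \<in> Theta n" if "g \<in> carrier (SnT n)" "x \<in> Theta n" for g x
    using that Gamma_closed by (cases g; cases x) (auto simp: SnT_carrier)
  have mult: "Gamma n (g \<otimes>\<^bsub>SnT n\<^esub> h) x = Gamma n g (Gamma n h x)"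
    if "g \<in> carrier (SnT n)" "h \<in> carrier (SnT n)" "x \<in> Theta n" for g h x
    using that Gamma_mult by (cases g; cases h; cases x) (auto simp: SnT_carrier)
  have ext: "Gamma n g \<in> extensional (Theta n)" for g
    by (cases g) (simp add: Gamma_def)
  have bij: "Gamma n g \<in> Bij (Theta n)" if g: "g \<in> carrier (SnT n)" for g
  proof -
    let ?h = "inv\<^bsub>SnT n\<^esub> g"
    have "bij_betw (Gamma n g) (Theta n) (Theta n)"
      by (rule bij_betw_byWitness[where f' = "Gamma n ?h"])
         (auto simp: closed g mult[symmetric] Gamma_one)
    then show ?thesis using ext by (simp add: Bij_def)
  qed
  have "Gamma n \<in> hom (SnT n) (BijGroup (Theta n))"
  proof (rule homI)
    fix g h assume "g \<in> carrier (SnT n)" "h \<in> carrier (SnT n)"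
    then show "Gamma n (g \<otimes>\<^bsub>SnT n\<^esub> h) = Gamma n g \<otimes>\<^bsub>BijGroup (Theta n)\<^esub> Gamma n h"
      by (auto simp: BijGroup_def bij compose_def mult intro!: extensionalityI[OF ext])
  qed (simp add: BijGroup_def bij)
  then show ?thesis
    by (intro group_action.intro group_hom.intro group_hom_axioms.intro group_BijGroup G.group_axioms)
qed

end

theory Submission
  imports Defs
begin

text \<open>
  Sorting the \<open>d\<close>-coordinates and then rotating each pair \<open>(v_i, v_(n+i))\<close> onto the nonnegative
  first axis moves every point of the parameter space to a canonical point \<open>(x, (sqrt r, 0))\<close>
  with \<open>x\<close> increasing. Since \<open>(x, r)\<close> is invariant under the action, the map sending \<open>(x, r)\<close> to
  the orbit of this canonical point is the two-sided inverse of \<open>f\<close>.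
\<close>

lemma ThetaD:
  assumes "(d, v) \<in> Theta n"
  shows "d \<in> pos_vecs n" "d \<in> carrier_vec n" "distinct (list_of_vec d)" "v \<in> carrier_vec (2 * n)"
    "\<And>l. l < n \<Longrightarrow> (v $ l)\<^sup>2 + (v $ (n + l))\<^sup>2 > 0"
  using assms by (auto simp: Theta_def pos_vecs_def)

text \<open>This carries coordinate permutations of vectors over to \<open>permute_list\<close>, so
  that multiset facts about lists apply to \<open>sort_vec\<close>.\<close>

lemma list_of_vec_perm:
  assumes "\<sigma> permutes {..<n}" "d \<in> carrier_vec n"
  shows "list_of_vec (vec n (\<lambda>i. d $ \<sigma> i)) = permute_list \<sigma> (list_of_vec d)"
  using assms permutes_in_image[OF assms(1)]
  by (intro nth_equalityI) (auto simp: list_of_vec_index permute_list_nth)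

lemma perm_matrix_vec_in_Theta:
  assumes "(d, v) \<in> Theta n" "\<sigma> \<in> carrier (Sn n)"
  shows "perm_matrix n \<sigma> *\<^sub>v d = vec n (\<lambda>i. d $ \<sigma> i)"
  using perm_matrix_vec ThetaD(2) assms by blast

lemma sort_vec_perm:
  assumes "\<sigma> \<in> carrier (Sn n)" "d \<in> carrier_vec n"
  shows "sort_vec (vec n (\<lambda>i. d $ \<sigma> i)) = sort_vec d"
proof -
  have s: "\<sigma> permutes {..<n}" using assms(1) by (simp add: Sn_def)
  have "mset (permute_list \<sigma> (list_of_vec d)) = mset (list_of_vec d)"
    using s assms(2) by (intro mset_permute_list) auto
  then have "sort (permute_list \<sigma> (list_of_vec d)) = sort (list_of_vec d)"
    by (intro properties_for_sort) auto
  then show ?thesis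
    unfolding sort_vec_def list_of_vec_perm[OF s assms(2)] by simp
qed

lemma sort_vec_dim: "d \<in> carrier_vec n \<Longrightarrow> sort_vec d \<in> carrier_vec n"
  by (auto simp: sort_vec_def intro!: carrier_vecI)

text \<open>A list and its sorted version have the same multiset of entries, so some permutation of
  positions takes one to the other.\<close>

lemma ex_sorting_perm:
  assumes "d \<in> carrier_vec n"
  obtains \<sigma> where "\<sigma> \<in> carrier (Sn n)" "perm_matrix n \<sigma> *\<^sub>v d = sort_vec d"
proof -
  obtain \<sigma> where s: "\<sigma> permutes {..<length (list_of_vec d)}"
    "permute_list \<sigma> (list_of_vec d) = sort (list_of_vec d)"
    by (metis mset_eq_permutation mset_sort)
  then have p: "\<sigma> permutes {..<n}" using assms by simp
  then have "\<sigma> \<in> carrier (Sn n)" by (simp add: Sn_def)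
  moreover from this have "perm_matrix n \<sigma> *\<^sub>v d = sort_vec d"
    unfolding sort_vec_def s(2)[symmetric]
      list_of_vec_perm[OF p assms, symmetric] vec_list
    by (rule perm_matrix_vec[OF _ assms])
  ultimately show ?thesis by (rule that)
qed

text \<open>Distinct entries make a coordinate of \<open>d\<close> determine its index. This is what
  makes the sorting permutation unique.\<close>

lemma perm_eqI:
  assumes d: "d \<in> carrier_vec n" "distinct (list_of_vec d)"
    and s: "\<sigma> \<in> carrier (Sn n)" "\<tau> \<in> carrier (Sn n)"
    and eq: "perm_matrix n \<sigma> *\<^sub>v d = perm_matrix n \<tau> *\<^sub>v d"
  shows "\<sigma> = \<tau>"
proof
  fix i
  show "\<sigma> i = \<tau> i"
  proof (cases "i < n")
    case True
    have "d $ \<sigma> i = d $ \<tau> i"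
      using arg_cong[OF eq, of "\<lambda>x. x $ i"] True perm_matrix_vec[OF _ d(1)] s by simp
    then show ?thesis
      using d perm_less[OF s(1) True] perm_less[OF s(2) True]
      by (metis carrier_vecD length_list_of_vec list_of_vec_index nth_eq_iff_index_eq)
  next
    \<comment> \<open>Both permutations fix every index outside \<open>{..<n}\<close>, so equality
      holds there as well.\<close>
    case False
    then show ?thesis using s by (simp add: Sn_def permutes_def)
  qed
qed

lemma R_map_perm:
  assumes "\<sigma> \<in> carrier (Sn n)" "v \<in> carrier_vec (2 * n)"
  shows "R_map n (perm_matrix2 n \<sigma> *\<^sub>v v) = vec n (\<lambda>i. (v $ \<sigma> i)\<^sup>2 + (v $ (n + \<sigma> i))\<^sup>2)"
  by (auto simp: R_map_def perm_matrix2_vec[OF assms] intro!: eq_vecI)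

text \<open>Rotation by \<open>t\<close> multiplies the complex number a + ib by exp(it), which has
  modulus 1. Hence torus elements leave the entries of \<open>R_map\<close> unchanged.\<close>

lemma norm_rotation:
  fixes t a b :: real
  shows "(cos t * a - sin t * b)\<^sup>2 + (sin t * a + cos t * b)\<^sup>2 = a\<^sup>2 + b\<^sup>2"
proof -
  have "(c * a - s * b)\<^sup>2 + (s * a + c * b)\<^sup>2 = (s\<^sup>2 + c\<^sup>2) * (a\<^sup>2 + b\<^sup>2)" for c s :: real
    by (simp add: power2_eq_square algebra_simps)
  from this[of "cos t" "sin t"] show ?thesis by simp
qed

text \<open>A nonzero a + ib becomes its modulus when multiplied by exp(it) with t = -arg(a + ib),
  taken modulo 2 pi.\<close>

lemma ex_rotation_to_axis:
  fixes a b :: real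
  assumes "a\<^sup>2 + b\<^sup>2 > 0"
  shows "\<exists>t. 0 \<le> t \<and> t < 2 * pi \<and> cos t * a - sin t * b = sqrt (a\<^sup>2 + b\<^sup>2)
    \<and> sin t * a + cos t * b = 0"
proof -
  define r where "r = sqrt (a\<^sup>2 + b\<^sup>2)"
  have r: "r > 0" "r\<^sup>2 = a\<^sup>2 + b\<^sup>2" using assms by (simp_all add: r_def)
  \<comment> \<open>The conjugate of (a + ib)/r lies on the unit circle; its angle is the required
    \<open>t\<close>.\<close>
  have "(a / r)\<^sup>2 + (- b / r)\<^sup>2 = 1"
    using r(1) unfolding power_divide power2_minus add_divide_distrib[symmetric] r(2)[symmetric]
    by simp
  then obtain t where t: "0 \<le> t" "t < 2 * pi" "a / r = cos t" "- b / r = sin t"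
    by (rule sincos_total_2pi)
  have "cos t * a - sin t * b = r"
    unfolding t(3,4)[symmetric] using r by (simp add: field_simps power2_eq_square)
  moreover have "sin t * a + cos t * b = 0"
    unfolding t(3,4)[symmetric] by simp
  ultimately show ?thesis using t(1,2) by (auto simp: r_def)
qed

text \<open>If \<open>\<sigma>'\<close> sorts the permuted vector \<open>d'\<close>, then
  \<open>\<tau> \<circ> \<sigma>'\<close> sorts \<open>d\<close>, so it equals
  \<open>\<sigma>\<close> by uniqueness. Both sides then compare the same pairs of coordinates, up
  to rotation.\<close>

lemma invariants_Gamma:
  assumes x: "(d, v) \<in> Theta n" and t: "\<tau> \<in> carrier (Sn n)"
    and g: "Gamma n (\<tau>, \<theta>) (d, v) = (d', v')"
    and s: "\<sigma> \<in> carrier (Sn n)" "perm_matrix n \<sigma> *\<^sub>v d = sort_vec d"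
    and s': "\<sigma>' \<in> carrier (Sn n)" "perm_matrix n \<sigma>' *\<^sub>v d' = sort_vec d'"
  shows "sort_vec d' = sort_vec d"
    "R_map n (perm_matrix2 n \<sigma>' *\<^sub>v v') = R_map n (perm_matrix2 n \<sigma> *\<^sub>v v)"
proof -
  have d': "d' = vec n (\<lambda>i. d $ \<tau> i)"
    and v': "v' = vec n (\<lambda>i. cos (\<theta> $ i) * v $ \<tau> i - sin (\<theta> $ i) * v $ (n + \<tau> i)) @\<^sub>v
      vec n (\<lambda>i. sin (\<theta> $ i) * v $ \<tau> i + cos (\<theta> $ i) * v $ (n + \<tau> i))"
    using g unfolding Gamma_vec[OF t x] by auto
  have y: "(d', v') \<in> Theta n" using Gamma_closed[OF t x, of \<theta>] g by simp
  show sort: "sort_vec d' = sort_vec d"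
    unfolding d' by (rule sort_vec_perm[OF t ThetaD(2)[OF x]])
  \<comment> \<open>In the reversed multiplication of \<open>Sn n\<close> this composite is the
    product of \<open>\<sigma>'\<close> and \<open>\<tau>\<close>, in that order.\<close>
  have st: "\<tau> \<circ> \<sigma>' \<in> carrier (Sn n)"
    using t s'(1) by (simp add: Sn_def permutes_compose)
  have "perm_matrix n (\<tau> \<circ> \<sigma>') *\<^sub>v d = perm_matrix n \<sigma>' *\<^sub>v d'"
    unfolding perm_matrix_vec_in_Theta[OF x st] perm_matrix_vec_in_Theta[OF y s'(1)]
    by (auto simp: d' perm_less[OF s'(1)])
  then have "\<tau> \<circ> \<sigma>' = \<sigma>"
    using perm_eqI[OF ThetaD(2,3)[OF x] st s(1)] s(2) s'(2) sort by simp
  then show "R_map n (perm_matrix2 n \<sigma>' *\<^sub>v v') = R_map n (perm_matrix2 n \<sigma> *\<^sub>v v)"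
    unfolding R_map_perm[OF s(1) ThetaD(4)[OF x]] R_map_perm[OF s'(1) ThetaD(4)[OF y]]
    by (auto simp: v' norm_rotation perm_less[OF s'(1)] trans_less_add1)
qed

text \<open>Well-definedness: the representative itself supplies a value for the definite
  description, and \<open>invariants_Gamma\<close> shows that every other representative gives the
  same one.\<close>

lemma f_map_orbit:
  assumes x: "(d, v) \<in> Theta n"
    and s: "\<sigma> \<in> carrier (Sn n)" "perm_matrix n \<sigma> *\<^sub>v d = sort_vec d"
  shows "f_map n (orbit (SnT n) (Gamma n) (d, v)) = (sort_vec d, R_map n (perm_matrix2 n \<sigma> *\<^sub>v v))"
  unfolding f_map_def
proof (rule the_equality)
  interpret group_action "SnT n" "Theta n" "Gamma n" by (rule group_action_Gamma)
  show "\<exists>(d', v')\<in>orbit (SnT n) (Gamma n) (d, v). \<exists>\<sigma>'\<in>carrier (Sn n).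
     perm_matrix n \<sigma>' *\<^sub>v d' = sort_vec d' \<and>
     (sort_vec d, R_map n (perm_matrix2 n \<sigma> *\<^sub>v v)) = (sort_vec d', R_map n (perm_matrix2 n \<sigma>' *\<^sub>v v'))"
    using orbit_refl[OF x] s by blast
next
  fix y
  assume "\<exists>(d', v')\<in>orbit (SnT n) (Gamma n) (d, v). \<exists>\<sigma>'\<in>carrier (Sn n).
     perm_matrix n \<sigma>' *\<^sub>v d' = sort_vec d' \<and> y = (sort_vec d', R_map n (perm_matrix2 n \<sigma>' *\<^sub>v v'))"
  then obtain d' v' \<sigma>' where y: "(d', v') \<in> orbit (SnT n) (Gamma n) (d, v)" "\<sigma>' \<in> carrier (Sn n)"
    "perm_matrix n \<sigma>' *\<^sub>v d' = sort_vec d'" "y = (sort_vec d', R_map n (perm_matrix2 n \<sigma>' *\<^sub>v v'))"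
    by blast
  obtain \<tau> \<theta> where "\<tau> \<in> carrier (Sn n)" "Gamma n (\<tau>, \<theta>) (d, v) = (d', v')"
    using y(1) unfolding orbit_def SnT_carrier by force
  from invariants_Gamma[OF x this s y(2,3)]
  show "y = (sort_vec d, R_map n (perm_matrix2 n \<sigma> *\<^sub>v v))" by (simp add: y(4))
qed

text \<open>The square root appears because \<open>R_map\<close> records squared moduli.\<close>

definition canonical_point :: "nat \<Rightarrow> real vec \<times> real vec \<Rightarrow> real vec \<times> real vec" where
  "canonical_point n = (\<lambda>(x, r). (x, vec n (\<lambda>i. sqrt (r $ i)) @\<^sub>v 0\<^sub>v n))"

lemma canonical_point_in_Theta:
  "y \<in> X_up n \<times> pos_vecs n \<Longrightarrow> canonical_point n y \<in> Theta n"
  by (auto simp: canonical_point_def Theta_def X_up_def pos_vecs_def intro!: carrier_vecI)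

text \<open>The vector \<open>x\<close> is already increasing, so \<open>id\<close> is its sorting
  permutation, and squaring the roots returns \<open>r\<close>. This makes
  \<open>canonical_point\<close> a right inverse of \<open>f_map\<close> after passing to
  orbits.\<close>

lemma f_map_canonical_point:
  assumes "y \<in> X_up n \<times> pos_vecs n"
  shows "f_map n (orbit (SnT n) (Gamma n) (canonical_point n y)) = y"
proof -
  obtain x r where y: "y = (x, r)" by (cases y)
  let ?v = "vec n (\<lambda>i. sqrt (r $ i)) @\<^sub>v 0\<^sub>v n"
  have th: "(x, ?v) \<in> Theta n"
    using canonical_point_in_Theta[OF assms] by (simp add: y canonical_point_def)
  have id: "id \<in> carrier (Sn n)" by (simp add: Sn_def permutes_id)
  have sort: "sort_vec x = x"
    using assms by (simp add: y sort_vec_def X_up_def sorted_sort_id vec_list)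
  have "perm_matrix n id *\<^sub>v x = sort_vec x"
    unfolding perm_matrix_vec_in_Theta[OF th id] sort using ThetaD(2)[OF th] by auto
  from f_map_orbit[OF th id this] show ?thesis
    unfolding R_map_perm[OF id ThetaD(4)[OF th]]
    using assms by (auto simp: y canonical_point_def sort pos_vecs_def intro!: eq_vecI)
qed

text \<open>The left-inverse half: the orbit of a point can be recovered from its invariants, since
  it contains the canonical point built from them.\<close>

lemma Gamma_to_canonical_point:
  assumes x: "(d, v) \<in> Theta n"
    and s: "\<sigma> \<in> carrier (Sn n)" "perm_matrix n \<sigma> *\<^sub>v d = sort_vec d"
  shows "canonical_point n (sort_vec d, R_map n (perm_matrix2 n \<sigma> *\<^sub>v v))
    \<in> orbit (SnT n) (Gamma n) (d, v)"
proof -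
  \<comment> \<open>Rotations act after the permutation, so the angle at position \<open>i\<close>
    must turn the original pair with index \<open>\<sigma> i\<close>.\<close>
  have "\<forall>i<n. \<exists>t. 0 \<le> t \<and> t < 2 * pi \<and>
    cos t * v $ \<sigma> i - sin t * v $ (n + \<sigma> i) = sqrt ((v $ \<sigma> i)\<^sup>2 + (v $ (n + \<sigma> i))\<^sup>2) \<and>
    sin t * v $ \<sigma> i + cos t * v $ (n + \<sigma> i) = 0"
    by (intro allI impI ex_rotation_to_axis ThetaD(5)[OF x] perm_less[OF s(1)])
  then obtain t where t: "\<And>i. i < n \<Longrightarrow> 0 \<le> t i \<and> t i < 2 * pi \<and>
    cos (t i) * v $ \<sigma> i - sin (t i) * v $ (n + \<sigma> i) = sqrt ((v $ \<sigma> i)\<^sup>2 + (v $ (n + \<sigma> i))\<^sup>2) \<and>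
    sin (t i) * v $ \<sigma> i + cos (t i) * v $ (n + \<sigma> i) = 0"
    by metis
  have "(\<sigma>, vec n t) \<in> carrier (SnT n)" using s(1) t by (simp add: SnT_carrier torus_def)
  moreover have "Gamma n (\<sigma>, vec n t) (d, v)
      = canonical_point n (sort_vec d, R_map n (perm_matrix2 n \<sigma> *\<^sub>v v))"
    unfolding Gamma_vec[OF s(1) x] R_map_perm[OF s(1) ThetaD(4)[OF x]]
    using t s(2) unfolding perm_matrix_vec_in_Theta[OF x s(1)]
    by (auto simp: canonical_point_def intro!: eq_vecI)
  ultimately show ?thesis unfolding orbit_def by (metis (mono_tags, lifting) mem_Collect_eq)
qed

text \<open>Sorting only rearranges the entries of \<open>d\<close>, so they stay positive and
  distinct; the entries of \<open>R_map\<close> are the sums of squares that \<open>Theta n\<close>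
  requires to be positive.\<close>

lemma f_map_value_in_range:
  assumes x: "(d, v) \<in> Theta n" and s: "\<sigma> \<in> carrier (Sn n)"
  shows "(sort_vec d, R_map n (perm_matrix2 n \<sigma> *\<^sub>v v)) \<in> X_up n \<times> pos_vecs n"
proof -
  have "sort_vec d $ i > 0" if "i < n" for i
  proof -
    have "sort (list_of_vec d) ! i \<in> set (list_of_vec d)"
      using that ThetaD(2)[OF x] by (metis carrier_vecD length_list_of_vec length_sort nth_mem set_sort)
    then show ?thesis
      using ThetaD(1)[OF x] that
      by (auto simp: sort_vec_def pos_vecs_def in_set_conv_nth list_of_vec_index vec_of_list_index)
  qed
  then have "sort_vec d \<in> X_up n"
    using ThetaD(2,3)[OF x] sort_vec_dim[of d n]
    by (simp add: X_up_def pos_vecs_def) (simp add: sort_vec_def list_vec)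
  moreover have "R_map n (perm_matrix2 n \<sigma> *\<^sub>v v) \<in> pos_vecs n"
    unfolding R_map_perm[OF s ThetaD(4)[OF x]]
    using ThetaD(5)[OF x] perm_less[OF s] by (simp add: pos_vecs_def)
  ultimately show ?thesis by simp
qed

theorem proposition4p20:
  fixes n :: nat
  assumes "n \<ge> 1"
  shows "(\<forall>(d, v)\<in>Theta n.
            (\<exists>!\<sigma>. \<sigma> \<in> carrier (Sn n) \<and> perm_matrix n \<sigma> *\<^sub>v d = sort_vec d) \<and>
            (\<forall>\<sigma>\<in>carrier (Sn n). perm_matrix n \<sigma> *\<^sub>v d = sort_vec d \<longrightarrow>
               f_map n (orbit (SnT n) (Gamma n) (d, v))
                 = (sort_vec d, R_map n (perm_matrix2 n \<sigma> *\<^sub>v v)))) \<and>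
         bij_betw (f_map n) (orbits (SnT n) (Theta n) (Gamma n)) (X_up n \<times> pos_vecs n)"
proof
  have "\<exists>!\<sigma>. \<sigma> \<in> carrier (Sn n) \<and> perm_matrix n \<sigma> *\<^sub>v d = sort_vec d"
    if x: "(d, v) \<in> Theta n" for d v
    using ex_sorting_perm[OF ThetaD(2)[OF x]] perm_eqI[OF ThetaD(2,3)[OF x]] by metis
  then show "\<forall>(d, v)\<in>Theta n.
      (\<exists>!\<sigma>. \<sigma> \<in> carrier (Sn n) \<and> perm_matrix n \<sigma> *\<^sub>v d = sort_vec d) \<and>
      (\<forall>\<sigma>\<in>carrier (Sn n). perm_matrix n \<sigma> *\<^sub>v d = sort_vec d \<longrightarrow>
         f_map n (orbit (SnT n) (Gamma n) (d, v))
           = (sort_vec d, R_map n (perm_matrix2 n \<sigma> *\<^sub>v v)))"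
    using f_map_orbit by blast
next
  interpret group_action "SnT n" "Theta n" "Gamma n" by (rule group_action_Gamma)
  let ?orb = "orbit (SnT n) (Gamma n)" and ?Y = "X_up n \<times> pos_vecs n"
  \<comment> \<open>Orbits partition \<open>Theta n\<close>, so two orbits with a common point
    coincide.\<close>
  have orbit_eq: "?orb y = ?orb x" if "x \<in> Theta n" "y \<in> ?orb x" for x y
  proof -
    have y: "y \<in> Theta n" using that orbits_coverture unfolding orbits_def by blast
    have "?orb x \<inter> ?orb y \<noteq> {}" using that(2) orbit_refl[OF y] by blast
    then show ?thesis
      using disjoint_union[of "?orb x" "?orb y"] that(1) y unfolding orbits_def by blast
  qed
  \<comment> \<open>Range and left inverse are proved together, from one representative of
    \<open>Q\<close> and its sorting permutation.\<close>
  have on_orbits: "f_map n Q \<in> ?Y \<and> ?orb (canonical_point n (f_map n Q)) = Q"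
    if Q_orbit: "Q \<in> orbits (SnT n) (Theta n) (Gamma n)" for Q
  proof -
    obtain d v where x: "(d, v) \<in> Theta n" and Q: "Q = ?orb (d, v)"
      using Q_orbit by (auto simp: orbits_def)
    obtain \<sigma> where s: "\<sigma> \<in> carrier (Sn n)" "perm_matrix n \<sigma> *\<^sub>v d = sort_vec d"
      using ex_sorting_perm[OF ThetaD(2)[OF x]] .
    show ?thesis
      using f_map_value_in_range[OF x s(1)] orbit_eq[OF x Gamma_to_canonical_point[OF x s]]
      by (simp add: Q f_map_orbit[OF x s])
  qed
  have orbit_canonical: "?orb (canonical_point n y) \<in> orbits (SnT n) (Theta n) (Gamma n)"
    if "y \<in> ?Y" for y
    using canonical_point_in_Theta[OF that] unfolding orbits_def by blast
  show "bij_betw (f_map n) (orbits (SnT n) (Theta n) (Gamma n)) ?Y"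
  proof (rule bij_betw_byWitness[where f' = "\<lambda>y. ?orb (canonical_point n y)"])
    show "\<forall>y\<in>?Y. f_map n (?orb (canonical_point n y)) = y"
      using f_map_canonical_point by blast
  qed (use on_orbits orbit_canonical in blast)+
qed

end
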